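(* Let $\chi(s) = \frac{1}{\pi}(2\pi)^s \sin\left(\frac{\pi s}{2}\right)\Gamma(1-s)$, and let $\mu_\chi(\sigma)$ be the Lindelöf function associated with $\chi$. Then $$\mu_\chi(\sigma) = \frac{1}{2} - \sigma \quad \text{for } -\infty < \sigma \leq \frac12, \qquad \mu_\chi(\sigma) = 0 \quad \text{for } \frac12 \leq \sigma < \infty.$$ In particular, the function $\mu_\chi$ is non-negative, continuous, non-increasing and convex downwards (i.e. convex) on $\mathbb{R}$, satisfies $\mu_\chi(1/2)=0$, and satisfies the functional equation $\mu_\chi(\sigma) - \mu_\chi(1-\sigma) = \frac12 - \sigma$ for all real $\sigma$.
   Context: The function $\chi$ is the ratio $\chi(s) = \zeta(s)/\zeta(1-s)$ occurring in the functional equation $\zeta(s) = \chi(s)\zeta(1-s)$ of the Riemann zeta function. For real $\sigma$, the Lindelöf function $\mu_\chi(\sigma)$ associated with $\chi$ is the infimum of the non-negative real numbers $A$ such that $|\chi(\sigma+i\tau)|\,\tau^{-A}$ is bounded as $\tau \to +\infty$. *)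

theory Defs
  imports "HOL-Analysis.Analysis"
begin

(* Gamma is total, with value 0 at its poles; so chi is a convention value only at s = 1, 2, 3, ...,
   which has no influence on the behaviour of chi for large imaginary part. *)
definition chi :: "complex \<Rightarrow> complex" where
  "chi s = 1 / of_real pi * of_real (2 * pi) powr s * sin (of_real pi * s / 2) * Gamma (1 - s)"

(* Bfun F at_top means boundedness for all sufficiently large tau.
   The infimum is the real one, so it is meaningful when some exponent A is admissible. *)
definition lindelof :: "(complex \<Rightarrow> complex) \<Rightarrow> real \<Rightarrow> real" where
  "lindelof f \<sigma> =
     Inf {A. 0 \<le> A \<and> Bfun (\<lambda>\<tau>. norm (f (Complex \<sigma> \<tau>)) * \<tau> powr (- A)) at_top}"

end

theory Submission
  imports Defs "HOL-Real_Asymp.Real_Asymp"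
begin

text \<open>
  Everything follows from the exact order of growth: for each fixed \<open>\<sigma>\<close>, the modulus
  \<open>|chi (\<sigma> + i \<tau>)|\<close> is bounded above and below by constant multiples of
  \<open>\<tau> powr (1/2 - \<sigma>)\<close> as \<open>\<tau> \<longrightarrow> \<infinity>\<close> (\<open>norm_chi_bigtheta\<close>). Then the admissible
  exponents are exactly those \<open>A \<ge> 0\<close> with \<open>A \<ge> 1/2 - \<sigma>\<close>, so the Lindelof function is
  \<open>max 0 (1/2 - \<sigma>)\<close>, from which all the listed properties can be read off.

  The usual source of this order is Stirling's formula. The proof here replaces it by a convexity
  argument in the style of Bohr and Mollerup. On a fixed horizontal line, \<open>|Gamma (x + i \<tau>)|\<close> need
  not be log-convex in \<open>x\<close>, but its product with \<open>Gamma x\<close> is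
  (\<open>convex_ln_norm_Gamma_times_Gamma\<close>), and the correcting factor does not depend on \<open>\<tau>\<close>.
  Convexity and \<open>Gamma (z + 1) = z * Gamma z\<close> together show that moving right by \<open>t\<close>
  multiplies \<open>|Gamma (a + i \<tau>)|\<close> by a factor of exact order \<open>\<tau> powr t\<close>
  (\<open>norm_Gamma_bigtheta\<close>). This compares \<open>chi\<close> on the line \<open>Re s = \<sigma>\<close>, for
  \<open>\<sigma> \<le> 1/2\<close>, with \<open>chi\<close> on the critical line, the sine factor having the same order on all
  vertical lines. On the critical line \<open>|chi| = 1\<close> because \<open>chi s * chi (1 - s) = 1\<close>, and this
  reflection also transfers the result from \<open>\<sigma> \<le> 1/2\<close> to \<open>\<sigma> \<ge> 1/2\<close>.
\<close>

section \<open>Log-convexity of the Gamma function on a horizontal line\<close>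

lemma convex_on_cong:
  assumes "\<And>x. x \<in> S \<Longrightarrow> f x = g x"
  shows "convex_on S f \<longleftrightarrow> convex_on S g"
  using assms by (auto simp: convex_on_def convex_def)

lemma convex_on_limit:
  fixes f :: "nat \<Rightarrow> 'a::real_vector \<Rightarrow> real"
  assumes "\<forall>\<^sub>F n in sequentially. convex_on S (f n)" "convex S"
    and "\<And>x. x \<in> S \<Longrightarrow> (\<lambda>n. f n x) \<longlonglongrightarrow> g x"
  shows "convex_on S g"
  unfolding convex_on_def
proof (intro conjI ballI allI impI)
  fix x y and u v :: real
  assume *: "x \<in> S" "y \<in> S" "0 \<le> u" "0 \<le> v" "u + v = 1"
  then have "u *\<^sub>R x + v *\<^sub>R y \<in> S"
    using assms(2) by (simp add: convexD)
  show "g (u *\<^sub>R x + v *\<^sub>R y) \<le> u * g x + v * g y"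
  proof (rule tendsto_le[OF sequentially_bot])
    show "(\<lambda>n. u * f n x + v * f n y) \<longlonglongrightarrow> u * g x + v * g y"
      using * by (intro tendsto_intros assms)
    show "(\<lambda>n. f n (u *\<^sub>R x + v *\<^sub>R y)) \<longlonglongrightarrow> g (u *\<^sub>R x + v *\<^sub>R y)"
      using assms(3) \<open>u *\<^sub>R x + v *\<^sub>R y \<in> S\<close> .
    show "\<forall>\<^sub>F n in sequentially. f n (u *\<^sub>R x + v *\<^sub>R y) \<le> u * f n x + v * f n y"
      using assms(1) by eventually_elim (use * in \<open>simp add: convex_on_def\<close>)
  qed
qed fact

text \<open>
  Minus the logarithm of one factor of the Gauss product for \<open>Gamma (x + i \<tau>) * Gamma x\<close>. The
  function \<open>- ln |x + k + i \<tau>|\<close> alone has second derivative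
  \<open>((x + k)\<^sup>2 - \<tau>\<^sup>2) / |x + k + i \<tau>|^4\<close>, which is negative for large \<open>\<tau>\<close>; the second
  derivative \<open>1 / (x + k)\<^sup>2\<close> of the real factor outweighs it.
\<close>
lemma convex_neg_ln_cmod_plus_ln:
  fixes k \<tau> :: real
  assumes "k \<ge> 0"
  shows "convex_on {0<..} (\<lambda>x. - (ln (cmod (Complex (x + k) \<tau>)) + ln (x + k)))"
proof -
  have *: "ln (cmod (Complex (x + k) \<tau>)) + ln (x + k) = ln ((x + k)\<^sup>2 + \<tau>\<^sup>2) / 2 + ln (x + k)" 
    if "x > 0" for x
    by (simp add: cmod_def ln_sqrt)
  have "convex_on {0<..} (\<lambda>x. - (ln ((x + k)\<^sup>2 + \<tau>\<^sup>2) / 2 + ln (x + k)))"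
  proof (rule f''_ge0_imp_convex[where f' = "\<lambda>x. - ((x + k) / ((x + k)\<^sup>2 + \<tau>\<^sup>2) + 1 / (x + k))"
        and f'' = "\<lambda>x. - ((\<tau>\<^sup>2 - (x + k)\<^sup>2) / ((x + k)\<^sup>2 + \<tau>\<^sup>2)\<^sup>2 - 1 / (x + k)\<^sup>2)"])
    fix x :: real assume "x \<in> {0<..}"
    then have x: "x + k > 0" using assms by simp
    then have p: "(x + k)\<^sup>2 + \<tau>\<^sup>2 > 0" by (simp add: sum_power2_gt_zero_iff)
    show "((\<lambda>x. - (ln ((x + k)\<^sup>2 + \<tau>\<^sup>2) / 2 + ln (x + k))) has_real_derivative
        - ((x + k) / ((x + k)\<^sup>2 + \<tau>\<^sup>2) + 1 / (x + k))) (at x)"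
      using x p by (auto intro!: derivative_eq_intros) (subst frac_eq_eq; (use p in linarith | algebra))
    show "((\<lambda>x. - ((x + k) / ((x + k)\<^sup>2 + \<tau>\<^sup>2) + 1 / (x + k))) has_real_derivative
        - ((\<tau>\<^sup>2 - (x + k)\<^sup>2) / ((x + k)\<^sup>2 + \<tau>\<^sup>2)\<^sup>2 - 1 / (x + k)\<^sup>2)) (at x)"
      using x p by (auto intro!: derivative_eq_intros simp: power2_eq_square diff_divide_distrib)
        (auto simp: power2_eq_square divide_simps)
    have "(\<tau>\<^sup>2 - (x + k)\<^sup>2) / ((x + k)\<^sup>2 + \<tau>\<^sup>2)\<^sup>2 \<le> ((x + k)\<^sup>2 + \<tau>\<^sup>2) / ((x + k)\<^sup>2 + \<tau>\<^sup>2)\<^sup>2"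
      by (intro divide_right_mono) auto
    also have "\<dots> = 1 / ((x + k)\<^sup>2 + \<tau>\<^sup>2)"
      using p by (simp add: power2_eq_square)
    also have "\<dots> \<le> 1 / (x + k)\<^sup>2"
      using x by (intro divide_left_mono) (auto intro: mult_pos_pos p)
    finally show "0 \<le> - ((\<tau>\<^sup>2 - (x + k)\<^sup>2) / ((x + k)\<^sup>2 + \<tau>\<^sup>2)\<^sup>2 - 1 / (x + k)\<^sup>2)"
      by simp
  qed simp
  then show ?thesis
    by (subst convex_on_cong[OF arg_cong[where f = uminus, OF *]]) auto
qed

lemma Complex_not_nonpos_Ints: "x > 0 \<Longrightarrow> Complex x \<tau> \<notin> \<int>\<^sub>\<le>\<^sub>0"
  by (auto elim!: nonpos_Ints_cases simp: complex_eq_iff)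

lemma norm_Gamma_times_Gamma_pos: "x > 0 \<Longrightarrow> norm (Gamma (Complex x \<tau>)) * Gamma x > 0"
  by (intro mult_pos_pos) (auto simp: Gamma_eq_zero_iff Complex_not_nonpos_Ints)

text \<open>
  The Gauss product turns the logarithm into a limit of functions that are affine in \<open>x\<close> plus
  finite sums of the convex functions above.
\<close>
lemma convex_ln_norm_Gamma_times_Gamma:
  fixes \<tau> :: real
  shows "convex_on {0<..} (\<lambda>x. ln (norm (Gamma (Complex x \<tau>)) * Gamma x))"
proof (rule convex_on_limit)
  let ?f = "\<lambda>n x. ln (norm (Gamma_series (Complex x \<tau>) n) * Gamma_series x n)"
  have eq: "?f n x = 2 * ln (fact n) + 2 * ln n * x
      + (\<Sum>k\<in>{0..n}. - (ln (cmod (Complex (x + real k) \<tau>)) + ln (x + real k)))"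
    if "x > 0" "n > 0" for n x
  proof -
    have nz: "Complex (x + k) \<tau> \<noteq> 0" for k :: nat
      using that by (auto simp: complex_eq_iff)
    have Cplus: "Complex x \<tau> + of_nat k = Complex (x + k) \<tau>" for k
      by (simp add: complex_eq_iff)
    have eq1: "norm (Gamma_series (Complex x \<tau>) n)
        = fact n * exp (x * ln n) / (\<Prod>k\<in>{0..n}. cmod (Complex (x + k) \<tau>))"
      by (simp add: Gamma_series_def norm_divide norm_mult pochhammer_prod prod_norm [symmetric]
          atLeastLessThanSuc_atLeastAtMost Cplus)
    have eq2: "Gamma_series x n = fact n * exp (x * ln n) / (\<Prod>k\<in>{0..n}. x + k)"
      by (simp add: Gamma_series_def pochhammer_prod atLeastLessThanSuc_atLeastAtMost)
    have p1: "(\<Prod>k\<in>{0..n}. cmod (Complex (x + k) \<tau>)) > 0"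
      using nz by (intro prod_pos) auto
    have p2: "(\<Prod>k\<in>{0..n}. x + k) > 0"
      using that by (intro prod_pos) auto
    have l1: "ln (\<Prod>k\<in>{0..n}. cmod (Complex (x + k) \<tau>)) = (\<Sum>k\<in>{0..n}. ln (cmod (Complex (x + k) \<tau>)))"
      using nz by (intro ln_prod) auto
    have l2: "ln (\<Prod>k\<in>{0..n}. x + k) = (\<Sum>k\<in>{0..n}. ln (x + k))"
      using that by (intro ln_prod) auto
    show ?thesis
      unfolding eq1 eq2 using less_imp_neq[OF p1] less_imp_neq[OF p2]
      by (simp add: ln_mult ln_div l1 l2 sum_negf sum.distrib sum_subtractf del: prod_zero_iff)
  qed
  show "\<forall>\<^sub>F n in sequentially. convex_on {0<..} (?f n)"
    using eventually_gt_at_top[of 0]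
  proof eventually_elim
    case (elim n)
    have s: "convex_on {0<..} (\<lambda>x. \<Sum>k\<in>K. - (ln (cmod (Complex (x + real k) \<tau>)) + ln (x + real k)))"
      if "finite K" for K :: "nat set"
      using that
    proof (induction K)
      case (insert k K)
      then show ?case
        using convex_on_add[OF convex_neg_ln_cmod_plus_ln[of "real k" \<tau>] insert.IH]
        by (simp only: sum.insert[OF insert.hyps] of_nat_0_le_iff simp_thms)
    qed (simp add: convex_on_const)
    have lin: "convex_on {0<..} (\<lambda>x::real. 2 * ln (fact n) + 2 * ln n * x)"
      by (auto simp: convex_on_def algebra_simps simp flip: distrib_left distrib_right)
    show ?case
      using convex_on_add[OF lin s[of "{0..n}"]] elim
      by (subst convex_on_cong[OF eq]) auto
  qed
  fix x :: real assume "x \<in> {0<..}"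
  then have x: "x > 0" by simp
  have "norm (Gamma (Complex x \<tau>)) * Gamma x \<noteq> 0"
    using norm_Gamma_times_Gamma_pos[OF x, of \<tau>] by (metis less_irrefl)
  then show "(\<lambda>n. ?f n x) \<longlonglongrightarrow> ln (norm (Gamma (Complex x \<tau>)) * Gamma x)"
    by (intro tendsto_intros)
qed auto

section \<open>Growth of the Gamma function along vertical lines\<close>

lemma Gamma_Complex_plus1:
  assumes "x > 0"
  shows "Gamma (Complex (x + 1) \<tau>) = Complex x \<tau> * Gamma (Complex x \<tau>)"
proof -
  have "Complex (x + 1) \<tau> = Complex x \<tau> + 1" by (simp add: complex_eq_iff)
  then show ?thesis
    using Gamma_plus1[OF Complex_not_nonpos_Ints[of x \<tau>]] assms by simp
qed

text \<open>
  Log-convexity bounds the value at \<open>a + t\<close> by the weighted geometric mean of the values at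
  \<open>a\<close> and \<open>a + 1\<close>, and the latter is known from the recurrence.
\<close>
lemma norm_Gamma_shift_le:
  fixes a t \<tau> :: real
  assumes "a > 0" "0 \<le> t" "t \<le> 1"
  shows "norm (Gamma (Complex (a + t) \<tau>))
    \<le> Gamma a * a powr t / Gamma (a + t) * (norm (Gamma (Complex a \<tau>)) * norm (Complex a \<tau>) powr t)"
proof -
  define G where "G = (\<lambda>x. norm (Gamma (Complex x \<tau>)) * Gamma x)"
  have pos: "G x > 0" if "x > 0" for x
    unfolding G_def using that by (rule norm_Gamma_times_Gamma_pos)
  have za: "Complex a \<tau> \<noteq> 0" using assms by (auto simp: complex_eq_iff)
  have "Gamma (a + 1) = a * Gamma a"
    using assms by (intro Gamma_plus1) (auto elim!: nonpos_Ints_cases)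
  then have G1: "G (a + 1) = G a * (norm (Complex a \<tau>) * a)"
    using assms by (simp add: G_def norm_mult Gamma_Complex_plus1)
  have "ln (G ((1 - t) *\<^sub>R a + t *\<^sub>R (a + 1))) \<le> (1 - t) * ln (G a) + t * ln (G (a + 1))"
    using convex_onD[OF convex_ln_norm_Gamma_times_Gamma[of \<tau>], of t a "a + 1"] assms
    by (simp add: G_def)
  also have "(1 - t) *\<^sub>R a + t *\<^sub>R (a + 1) = a + t" by (simp add: algebra_simps)
  also have "(1 - t) * ln (G a) + t * ln (G (a + 1)) = ln (G a * (norm (Complex a \<tau>) * a) powr t)"
    unfolding G1 using pos[of a] za assms by (simp add: ln_mult ln_powr algebra_simps)
  finally have "G (a + t) \<le> G a * (norm (Complex a \<tau>) * a) powr t"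
    using pos[of a] pos[of "a + t"] za assms by (subst (asm) ln_le_cancel_iff) auto
  then show ?thesis
    using Gamma_real_pos[of "a + t"] assms
    by (simp add: G_def powr_mult field_simps)
qed

text \<open>
  The lower bound is the upper bound for the step \<open>1 - t\<close> from \<open>a + t\<close> to \<open>a + 1\<close>, since
  the whole step from \<open>a\<close> to \<open>a + 1\<close> multiplies by \<open>|a + i \<tau>|\<close> exactly.
\<close>
lemma norm_Gamma_shift_bigtheta:
  fixes a t :: real
  assumes "a > 0" "0 \<le> t" "t \<le> 1"
  shows "(\<lambda>\<tau>. norm (Gamma (Complex (a + t) \<tau>))) \<in> \<Theta>(\<lambda>\<tau>. \<tau> powr t * norm (Gamma (Complex a \<tau>)))"
proof -
  have up: "(\<lambda>\<tau>. norm (Gamma (Complex (a + t) \<tau>))) \<in> O(\<lambda>\<tau>. \<tau> powr t * norm (Gamma (Complex a \<tau>)))"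
    if "a > 0" "0 \<le> t" "t \<le> 1" for a t :: real
  proof -
    have "(\<lambda>\<tau>. norm (Gamma (Complex (a + t) \<tau>)))
        \<in> O(\<lambda>\<tau>. norm (Gamma (Complex a \<tau>)) * norm (Complex a \<tau>) powr t)"
      by (rule bigoI[where c = "Gamma a * a powr t / Gamma (a + t)"])
        (use norm_Gamma_shift_le[OF that] in auto)
    also have "(\<lambda>\<tau>. norm (Complex a \<tau>) powr t) \<in> \<Theta>(\<lambda>\<tau>. \<tau> powr t)"
      unfolding cmod_def complex.sel by real_asymp
    then have "(\<lambda>\<tau>. norm (Gamma (Complex a \<tau>)) * norm (Complex a \<tau>) powr t)
        \<in> \<Theta>(\<lambda>\<tau>. \<tau> powr t * norm (Gamma (Complex a \<tau>)))"
      by (subst mult.commute) (rule landau_theta.mult_right)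
    finally show ?thesis .
  qed
  have "(\<lambda>\<tau>. \<tau> powr t * norm (Gamma (Complex a \<tau>))) \<in> O(\<lambda>\<tau>. norm (Gamma (Complex (a + t) \<tau>)))"
  proof -
    have "(\<lambda>\<tau>. norm (Complex a \<tau>)) \<in> \<Theta>(\<lambda>\<tau>. \<tau>)"
      unfolding cmod_def complex.sel by real_asymp
    then have "(\<lambda>\<tau>. \<tau> * norm (Gamma (Complex a \<tau>)))
        \<in> \<Theta>(\<lambda>\<tau>. norm (Complex a \<tau>) * norm (Gamma (Complex a \<tau>)))"
      by (subst bigtheta_sym) (rule landau_theta.mult_right)
    also have "(\<lambda>\<tau>. norm (Complex a \<tau>) * norm (Gamma (Complex a \<tau>)))
        = (\<lambda>\<tau>. norm (Gamma (Complex (a + t + (1 - t)) \<tau>)))"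
      using assms by (simp add: Gamma_Complex_plus1 norm_mult)
    also have "\<dots> \<in> O(\<lambda>\<tau>. \<tau> powr (1 - t) * norm (Gamma (Complex (a + t) \<tau>)))"
      using assms by (intro up) auto
    finally have *: "(\<lambda>\<tau>. \<tau> * norm (Gamma (Complex a \<tau>)))
        \<in> O(\<lambda>\<tau>. \<tau> powr (1 - t) * norm (Gamma (Complex (a + t) \<tau>)))" .
    have "(\<lambda>\<tau>. \<tau> powr t * norm (Gamma (Complex a \<tau>)))
        \<in> \<Theta>(\<lambda>\<tau>. \<tau> powr (t - 1) * (\<tau> * norm (Gamma (Complex a \<tau>))))"
      by (intro bigthetaI_cong eventually_mono[OF eventually_gt_at_top[of 0]])
        (simp add: powr_diff)
    also have "(\<lambda>\<tau>. \<tau> powr (t - 1) * (\<tau> * norm (Gamma (Complex a \<tau>))))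
        \<in> O(\<lambda>\<tau>. \<tau> powr (t - 1) * (\<tau> powr (1 - t) * norm (Gamma (Complex (a + t) \<tau>))))"
      by (intro landau_o.big.mult_left *)
    also have "(\<lambda>\<tau>. \<tau> powr (t - 1) * (\<tau> powr (1 - t) * norm (Gamma (Complex (a + t) \<tau>))))
        \<in> \<Theta>(\<lambda>\<tau>. norm (Gamma (Complex (a + t) \<tau>)))"
      by (intro bigthetaI_cong eventually_mono[OF eventually_gt_at_top[of 0]])
        (simp add: mult.assoc[symmetric] flip: powr_add)
    finally show ?thesis .
  qed
  with up[OF assms] show ?thesis by (auto simp: bigtheta_def bigomega_iff_bigo)
qed

lemma norm_Gamma_bigtheta:
  fixes a b :: real
  assumes "a > 0" "a \<le> b"
  shows "(\<lambda>\<tau>. norm (Gamma (Complex b \<tau>))) \<in> \<Theta>(\<lambda>\<tau>. \<tau> powr (b - a) * norm (Gamma (Complex a \<tau>)))"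
proof -
  have "(\<lambda>\<tau>. norm (Gamma (Complex b \<tau>))) \<in> \<Theta>(\<lambda>\<tau>. \<tau> powr (b - a) * norm (Gamma (Complex a \<tau>)))"
    if "a \<le> b" "b \<le> a + real n" for n b
    using that
  proof (induction n arbitrary: b)
    case 0
    then have "b = a + 0" by simp
    then show ?case using norm_Gamma_shift_bigtheta[of a 0] assms by simp
  next
    case (Suc n)
    show ?case
    proof (cases "b \<le> a + 1")
      case True
      then show ?thesis using norm_Gamma_shift_bigtheta[of a "b - a"] assms Suc.prems by simp
    next
      case False
      have "(\<lambda>\<tau>. norm (Gamma (Complex b \<tau>))) \<in> \<Theta>(\<lambda>\<tau>. \<tau> powr 1 * norm (Gamma (Complex (b - 1) \<tau>)))"
        using norm_Gamma_shift_bigtheta[of "b - 1" 1] assms False by simp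
      also have "(\<lambda>\<tau>. \<tau> powr 1 * norm (Gamma (Complex (b - 1) \<tau>)))
          \<in> \<Theta>(\<lambda>\<tau>. \<tau> powr 1 * (\<tau> powr (b - 1 - a) * norm (Gamma (Complex a \<tau>))))"
        using False Suc.prems by (intro landau_theta.mult_left Suc.IH) auto
      also have "(\<lambda>\<tau>. \<tau> powr 1 * (\<tau> powr (b - 1 - a) * norm (Gamma (Complex a \<tau>))))
          = (\<lambda>\<tau>. \<tau> powr (b - a) * norm (Gamma (Complex a \<tau>)))"
        by (simp only: mult.assoc[symmetric] powr_add[symmetric]) simp
      finally show ?thesis .
    qed
  qed
  from this[OF assms(2), of "nat \<lceil>b - a\<rceil>"] show ?thesis by linarith
qed

section \<open>The order of chi\<close>

lemma norm_sin_bigtheta: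
  "(\<lambda>\<tau>. norm (sin (of_real pi * Complex \<sigma> \<tau> / 2))) \<in> \<Theta>(\<lambda>\<tau>. exp (pi * \<tau> / 2))"
proof -
  have "norm (sin z) = sqrt ((exp (2 * Im z) + inverse (exp (2 * Im z)) - 2 * cos (2 * Re z)) / 4)" for z
    using norm_sin_squared[of z] by (metis norm_ge_zero real_sqrt_unique)
  then have "(\<lambda>\<tau>. norm (sin (of_real pi * Complex \<sigma> \<tau> / 2)))
      = (\<lambda>\<tau>. sqrt ((exp (pi * \<tau>) + inverse (exp (pi * \<tau>)) - 2 * cos (pi * \<sigma>)) / 4))"
    by simp
  also have "\<dots> \<in> \<Theta>(\<lambda>\<tau>. exp (pi * \<tau> / 2))"
    by real_asymp
  finally show ?thesis .
qed

text \<open>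
  The functional equation \<open>\<zeta>(s) = chi(s) \<zeta>(1 - s)\<close>, applied twice, suggests this identity;
  it is Euler's reflection formula combined with the double-angle formula. The hypothesis avoids
  the poles of both Gamma factors.
\<close>
lemma chi_mult_chi_reflect:
  assumes "Im s \<noteq> 0"
  shows "chi s * chi (1 - s) = 1"
proof -
  have sin: "sin (of_real pi * s) \<noteq> 0"
  proof
    assume "sin (of_real pi * s) = 0"
    then obtain n :: int where "of_real pi * s = of_real (n * pi)"
      unfolding sin_eq_0 by blast
    then have "Im (of_real pi * s) = 0" by simp
    with assms show False by simp
  qed
  have "sin (of_real pi * (1 - s) / 2) = cos (of_real pi * s / 2)"
    by (simp add: sin_cos_eq algebra_simps diff_divide_distrib)
  then have *: "2 * (sin (of_real pi * s / 2) * sin (of_real pi * (1 - s) / 2)) = sin (of_real pi * s)"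
    using sin_double[of "of_real pi * s / 2"] by simp
  have powr: "(of_real (2 * pi) powr s * of_real (2 * pi) powr (1 - s) :: complex) = of_real (2 * pi)"
    by (simp flip: powr_add)
  have "chi s * chi (1 - s) = 1 / of_real pi ^ 2 * (of_real (2 * pi) powr s * of_real (2 * pi) powr (1 - s))
      * (sin (of_real pi * s / 2) * sin (of_real pi * (1 - s) / 2)) * (Gamma s * Gamma (1 - s))"
    unfolding chi_def by (simp add: power2_eq_square mult_ac)
  also have "\<dots> = 1 / of_real pi * (2 * (sin (of_real pi * s / 2) * sin (of_real pi * (1 - s) / 2)))
      * (of_real pi / sin (of_real pi * s))"
    by (subst powr) (simp add: Gamma_reflection_complex power2_eq_square)
  also have "\<dots> = 1" unfolding * using sin by simp
  finally show ?thesis .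
qed

lemma cnj_chi: "cnj (chi s) = chi (cnj s)"
  unfolding chi_def
  by (simp add: cnj_Gamma cnj_sin del: of_real_mult) (subst cnj_powr, auto)

text \<open>
  Conjugation brings \<open>1 - s\<close> back to the upper half-plane, so that both factors have the same
  imaginary part \<open>\<tau>\<close>.
\<close>
lemma norm_chi_reflect:
  assumes "\<tau> \<noteq> 0"
  shows "norm (chi (Complex \<sigma> \<tau>)) * norm (chi (Complex (1 - \<sigma>) \<tau>)) = 1"
proof -
  have cnj1: "cnj (1 - Complex \<sigma> \<tau>) = Complex (1 - \<sigma>) \<tau>" by (simp add: complex_eq_iff)
  have "norm (chi (Complex (1 - \<sigma>) \<tau>)) = norm (chi (1 - Complex \<sigma> \<tau>))"
    using cnj_chi[of "1 - Complex \<sigma> \<tau>"] cnj1 by (metis complex_mod_cnj)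
  then show ?thesis
    using chi_mult_chi_reflect[of "Complex \<sigma> \<tau>"] assms by (metis complex.sel(2) norm_mult norm_one)
qed

text \<open>
  For \<open>\<sigma> \<le> 1/2\<close> the Gamma factor is taken at real part \<open>1 - \<sigma> \<ge> 1/2\<close>, and comparing it
  with its value at real part \<open>1/2\<close> reduces the claim to \<open>|chi (1/2 + i \<tau>)| = 1\<close>. In this
  way the exponential decay of Gamma never has to be computed: it cancels against the sine. For
  \<open>\<sigma> > 1/2\<close> the reflection formula is used.
\<close>
lemma norm_chi_bigtheta:
  "(\<lambda>\<tau>. norm (chi (Complex \<sigma> \<tau>))) \<in> \<Theta>(\<lambda>\<tau>. \<tau> powr (1/2 - \<sigma>))"
proof -
  have left: "(\<lambda>\<tau>. norm (chi (Complex \<sigma> \<tau>))) \<in> \<Theta>(\<lambda>\<tau>. \<tau> powr (1/2 - \<sigma>))" if "\<sigma> \<le> 1/2" for \<sigma>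
  proof -
    let ?E = "\<lambda>\<sigma> \<tau>. exp (pi * \<tau> / 2) * norm (Gamma (Complex (1 - \<sigma>) \<tau>))"
    have chi: "(\<lambda>\<tau>. norm (chi (Complex \<sigma> \<tau>))) \<in> \<Theta>(?E \<sigma>)" for \<sigma>
    proof -
      have "norm (Gamma (1 - Complex \<sigma> \<tau>)) = norm (Gamma (Complex (1 - \<sigma>) \<tau>))" for \<tau>
      proof -
        have "cnj (1 - Complex \<sigma> \<tau>) = Complex (1 - \<sigma>) \<tau>" by (simp add: complex_eq_iff)
        then show ?thesis
          using cnj_Gamma[of "1 - Complex \<sigma> \<tau>"] by (metis complex_mod_cnj)
      qed
      then have "(\<lambda>\<tau>. norm (chi (Complex \<sigma> \<tau>))) = (\<lambda>\<tau>. ((2 * pi) powr \<sigma> / pi)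
          * (norm (sin (of_real pi * Complex \<sigma> \<tau> / 2)) * norm (Gamma (Complex (1 - \<sigma>) \<tau>))))"
        by (simp add: chi_def norm_mult norm_divide norm_powr_real_powr mult_ac)
      also have "\<dots> \<in> \<Theta>(\<lambda>\<tau>. norm (sin (of_real pi * Complex \<sigma> \<tau> / 2)) * norm (Gamma (Complex (1 - \<sigma>) \<tau>)))"
        by simp
      also have "(\<lambda>\<tau>. norm (sin (of_real pi * Complex \<sigma> \<tau> / 2)) * norm (Gamma (Complex (1 - \<sigma>) \<tau>)))
          \<in> \<Theta>(?E \<sigma>)"
        by (intro landau_theta.mult_right norm_sin_bigtheta)
      finally show ?thesis .
    qed
    have "norm (chi (Complex (1/2) \<tau>)) = 1" if "\<tau> > 0" for \<tau>
    proof -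
      have "norm (chi (Complex (1/2) \<tau>)) * norm (chi (Complex (1/2) \<tau>)) = 1"
        using norm_chi_reflect[of \<tau> "1/2"] that by simp
      then show ?thesis
        using norm_ge_zero[of "chi (Complex (1/2) \<tau>)"] unfolding square_eq_1_iff by linarith
    qed
    then have half: "(\<lambda>_. 1) \<in> \<Theta>(\<lambda>\<tau>. norm (chi (Complex (1/2) \<tau>)))"
      by (intro bigthetaI_cong eventually_mono[OF eventually_gt_at_top[of 0]]) auto
    have "(\<lambda>\<tau>. norm (chi (Complex \<sigma> \<tau>))) \<in> \<Theta>(?E \<sigma>)" by (rule chi)
    also have "?E \<sigma> \<in> \<Theta>(\<lambda>\<tau>. exp (pi * \<tau> / 2) * (\<tau> powr (1 - \<sigma> - 1/2) * norm (Gamma (Complex (1/2) \<tau>))))"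
      using that by (intro landau_theta.mult_left norm_Gamma_bigtheta) auto
    also have "(\<lambda>\<tau>. exp (pi * \<tau> / 2) * (\<tau> powr (1 - \<sigma> - 1/2) * norm (Gamma (Complex (1/2) \<tau>))))
        = (\<lambda>\<tau>. \<tau> powr (1/2 - \<sigma>) * ?E (1/2) \<tau>)"
      by (simp add: mult_ac)
    also have "(\<lambda>\<tau>. \<tau> powr (1/2 - \<sigma>) * ?E (1/2) \<tau>) \<in> \<Theta>(\<lambda>\<tau>. \<tau> powr (1/2 - \<sigma>) * 1)"
      by (intro landau_theta.mult_left, subst bigtheta_sym) (rule landau_theta.trans[OF half chi])
    finally show ?thesis by simp
  qed
  show ?thesis
  proof (cases "\<sigma> \<le> 1/2")
    case False
    have "(\<lambda>\<tau>. norm (chi (Complex \<sigma> \<tau>))) \<in> \<Theta>(\<lambda>\<tau>. inverse (norm (chi (Complex (1 - \<sigma>) \<tau>))))"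
    proof (intro bigthetaI_cong eventually_mono[OF eventually_gt_at_top[of 0]])
      fix \<tau> :: real assume "\<tau> > 0"
      then show "norm (chi (Complex \<sigma> \<tau>)) = inverse (norm (chi (Complex (1 - \<sigma>) \<tau>)))"
        using norm_chi_reflect[of \<tau> "1 - \<sigma>"] by (intro inverse_unique[symmetric]) simp
    qed
    also have "(\<lambda>\<tau>. inverse (norm (chi (Complex (1 - \<sigma>) \<tau>)))) \<in> \<Theta>(\<lambda>\<tau>. inverse (\<tau> powr (1/2 - (1 - \<sigma>))))"
      using False by (subst bigtheta_inverse, intro left) auto
    also have "(\<lambda>\<tau>. inverse (\<tau> powr (1/2 - (1 - \<sigma>)))) = (\<lambda>\<tau>. \<tau> powr (1/2 - \<sigma>))"
      by (simp flip: powr_minus)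
    finally show ?thesis .
  qed (rule left)
qed

section \<open>The Lindelof function\<close>

text \<open>
  The admissible exponents form the closed half-line from \<open>max 0 c\<close>: because \<open>\<tau> powr c\<close> is
  the exact order, the endpoint is attained and every smaller exponent fails.
\<close>
lemma lindelof_eq_max:
  assumes "(\<lambda>\<tau>. norm (f (Complex \<sigma> \<tau>))) \<in> \<Theta>(\<lambda>\<tau>. \<tau> powr c)"
  shows "lindelof f \<sigma> = max 0 c"
proof -
  have Bfun_iff: "Bfun (\<lambda>\<tau>. norm (f (Complex \<sigma> \<tau>)) * \<tau> powr (- A)) at_top \<longleftrightarrow> c \<le> A" for A
  proof -
    have "Bfun (\<lambda>\<tau>. norm (f (Complex \<sigma> \<tau>)) * \<tau> powr (- A)) at_top
        \<longleftrightarrow> (\<lambda>\<tau>. norm (f (Complex \<sigma> \<tau>)) * \<tau> powr (- A)) \<in> O(\<lambda>_. 1)"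
      by (simp add: Bfun_def bigo_def)
    also have "\<dots> \<longleftrightarrow> (\<lambda>\<tau>. \<tau> powr c * \<tau> powr (- A)) \<in> O(\<lambda>_. 1)"
      by (rule landau_o.big.in_cong_bigtheta landau_theta.mult_right assms)+
    also have "\<dots> \<longleftrightarrow> (\<lambda>\<tau>. \<tau> powr (c - A)) \<in> O(\<lambda>\<tau>. \<tau> powr 0)"
      by (intro arg_cong2[where f = "(\<in>)"] landau_o.big.cong eventually_mono[OF eventually_gt_at_top[of 0]])
        (auto simp flip: powr_add)
    also have "\<dots> \<longleftrightarrow> c \<le> A"
      by (subst powr_bigo_iff) (auto intro: filterlim_ident)
    finally show ?thesis .
  qed
  have "lindelof f \<sigma> = Inf {max 0 c..}"
    unfolding lindelof_def Bfun_iff by (intro arg_cong[where f = Inf]) auto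
  then show ?thesis by simp
qed

theorem mainTheorem2:
  shows "(\<forall>\<sigma>. \<sigma> \<le> 1/2 \<longrightarrow> lindelof chi \<sigma> = 1/2 - \<sigma>)
    \<and> (\<forall>\<sigma>. 1/2 \<le> \<sigma> \<longrightarrow> lindelof chi \<sigma> = 0)
    \<and> (\<forall>\<sigma>. 0 \<le> lindelof chi \<sigma>)
    \<and> continuous_on UNIV (lindelof chi)
    \<and> antimono (lindelof chi)
    \<and> convex_on UNIV (lindelof chi)
    \<and> lindelof chi (1/2) = 0
    \<and> (\<forall>\<sigma>. lindelof chi \<sigma> - lindelof chi (1 - \<sigma>) = 1/2 - \<sigma>)"
proof -
  have eq: "lindelof chi = (\<lambda>\<sigma>. max 0 (1/2 - \<sigma>))"
    using lindelof_eq_max[OF norm_chi_bigtheta] by (intro ext)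
  have "continuous_on UNIV (lindelof chi)"
    unfolding eq by (intro continuous_intros)
  moreover have "convex_on UNIV (lindelof chi)"
    unfolding eq
  proof (rule convex_onI)
    fix t x y :: real assume t: "0 < t" "t < 1"
    have "(1 - t) * (1/2 - x) + t * (1/2 - y) \<le> (1 - t) * max 0 (1/2 - x) + t * max 0 (1/2 - y)"
      using t by (intro add_mono mult_left_mono) auto
    moreover have "0 \<le> (1 - t) * max 0 (1/2 - x) + t * max 0 (1/2 - y)"
      using t by simp
    moreover have "1/2 - ((1 - t) *\<^sub>R x + t *\<^sub>R y) = (1 - t) * (1/2 - x) + t * (1/2 - y)"
      by (simp add: field_simps)
    ultimately show "max 0 (1/2 - ((1 - t) *\<^sub>R x + t *\<^sub>R y))
        \<le> (1 - t) * max 0 (1/2 - x) + t * max 0 (1/2 - y)"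
      by linarith
  qed simp
  ultimately show ?thesis
    by (auto simp: eq antimono_def)
qed

end
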